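(* Let $\mathcal{C}$ be a finitely complete category with coequalizers and finite coproducts in which regular epimorphisms are closed under composition, let $n$ be a natural number, and let $H\colon\mathcal{C}^n\to\mathcal{C}^n$ be a monomorphism-preserving functor. If $\mathcal{C}$ is extensive, then every $H$-coalgebra $\xi\colon X\to HX$ and its induced $H\Delta\coprod$-coalgebra $$X\xrightarrow{\xi}HX\xrightarrow{H\eta_X}H\Delta\textstyle\coprod X$$ have the same quotients (i.e. a regular epimorphism $q\colon X\twoheadrightarrow Y$ in $\mathcal{C}^n$ carries an $H$-coalgebra morphism with domain $(X,\xi)$ if and only if it carries an $H\Delta\coprod$-coalgebra morphism with domain $(X,H\eta_X\cdot\xi)$) and, hence, the same simple quotient.
   Context: $\Delta\colon\mathcal{C}\to\mathcal{C}^n$, $\Delta(X)=(X,\dots,X)$, is the diagonal functor, with left adjoint $\coprod\colon\mathcal{C}^n\to\mathcal{C}$, $\coprod(X_1,\dots,X_n)=X_1+\dots+X_n$; the unit $\eta_X\colon X\to\Delta\coprod X$ consists of the coproduct injections. For an endofunctor $F$, an $F$-coalgebra is a morphism $\xi\colon X\to FX$, and a coalgebra morphism $(X,\xi)\to(Y,\zeta)$ is a morphism $h$ with $\zeta\cdot h=Fh\cdot\xi$. A quotient of a coalgebra is a coalgebra morphism with that domain carried by a regular epimorphism of the base category; a coalgebra is simple if each of its quotients is an isomorphism; a simple quotient is a quotient with simple codomain (unique up to isomorphism if it exists). A category $\mathcal{C}$ with finite coproducts is extensive if for all objects $Y_1,Y_2$ the canonical functor $\mathcal{C}/Y_1\times\mathcal{C}/Y_2\to\mathcal{C}/(Y_1+Y_2)$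 is an equivalence of categories. *)

theory Defs
  imports "HOL-Library.FuncSet"
begin

text \<open>
  \<open>g \<cdot>\<^bsub>C\<^esub> f\<close> (first \<open>f\<close>, then \<open>g\<close>) is meaningful only for arrows with \<open>Cod f = Dom g\<close>;
  nothing is assumed about the operations outside the carriers.
\<close>

record ('o, 'a) cat =
  Ob :: "'o set"
  Ar :: "'a set"
  Dom :: "'a \<Rightarrow> 'o"
  Cod :: "'a \<Rightarrow> 'o"
  Id :: "'o \<Rightarrow> 'a"
  Comp :: "'a \<Rightarrow> 'a \<Rightarrow> 'a"  (infixr "\<cdot>\<index>" 70)

definition hom :: "('o, 'a) cat \<Rightarrow> 'o \<Rightarrow> 'o \<Rightarrow> 'a set" where
  "hom C A B = {f \<in> Ar C. Dom C f = A \<and> Cod C f = B}"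

locale category =
  fixes C :: "('o, 'a) cat" (structure)
  assumes Dom_Ob: "f \<in> Ar C \<Longrightarrow> Dom C f \<in> Ob C"
    and Cod_Ob: "f \<in> Ar C \<Longrightarrow> Cod C f \<in> Ob C"
    and Id_hom: "A \<in> Ob C \<Longrightarrow> Id C A \<in> hom C A A"
    and Comp_hom: "\<lbrakk>f \<in> hom C A B; g \<in> hom C B D\<rbrakk> \<Longrightarrow> g \<cdot> f \<in> hom C A D"
    and Comp_Id: "f \<in> hom C A B \<Longrightarrow> f \<cdot> Id C A = f"
    and Id_Comp: "f \<in> hom C A B \<Longrightarrow> Id C B \<cdot> f = f"
    and Comp_assoc: "\<lbrakk>f \<in> hom C A B; g \<in> hom C B D; h \<in> hom C D E\<rbrakk>
                      \<Longrightarrow> (h \<cdot> g) \<cdot> f = h \<cdot> (g \<cdot> f)"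

definition monic :: "('o, 'a) cat \<Rightarrow> 'a \<Rightarrow> bool" where
  "monic C m \<longleftrightarrow> m \<in> Ar C \<and>
     (\<forall>A. \<forall>f \<in> hom C A (Dom C m). \<forall>g \<in> hom C A (Dom C m).
        m \<cdot>\<^bsub>C\<^esub> f = m \<cdot>\<^bsub>C\<^esub> g \<longrightarrow> f = g)"

definition is_iso :: "('o, 'a) cat \<Rightarrow> 'a \<Rightarrow> bool" where
  "is_iso C f \<longleftrightarrow> f \<in> Ar C \<and>
     (\<exists>g \<in> hom C (Cod C f) (Dom C f).
        g \<cdot>\<^bsub>C\<^esub> f = Id C (Dom C f) \<and> f \<cdot>\<^bsub>C\<^esub> g = Id C (Cod C f))"

record ('o, 'a, 'p, 'b) cfunctor =
  FOb :: "'o \<Rightarrow> 'p"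
  FAr :: "'a \<Rightarrow> 'b"

definition is_functor ::
  "('o, 'a) cat \<Rightarrow> ('p, 'b) cat \<Rightarrow> ('o, 'a, 'p, 'b) cfunctor \<Rightarrow> bool" where
  "is_functor C D F \<longleftrightarrow>
     (\<forall>A \<in> Ob C. FOb F A \<in> Ob D) \<and>
     (\<forall>f \<in> Ar C. FAr F f \<in> hom D (FOb F (Dom C f)) (FOb F (Cod C f))) \<and>
     (\<forall>A \<in> Ob C. FAr F (Id C A) = Id D (FOb F A)) \<and>
     (\<forall>f \<in> Ar C. \<forall>g \<in> Ar C. Dom C g = Cod C f \<longrightarrow>
        FAr F (g \<cdot>\<^bsub>C\<^esub> f) = FAr F g \<cdot>\<^bsub>D\<^esub> FAr F f)"

definition id_functor :: "('o, 'a, 'o, 'a) cfunctor" where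
  "id_functor = \<lparr>FOb = (\<lambda>A. A), FAr = (\<lambda>f. f)\<rparr>"

definition comp_functor ::
  "('p, 'b, 'q, 'c) cfunctor \<Rightarrow> ('o, 'a, 'p, 'b) cfunctor \<Rightarrow> ('o, 'a, 'q, 'c) cfunctor"
  (infixr "\<circ>\<^sub>F" 55) where
  "G \<circ>\<^sub>F F = \<lparr>FOb = (\<lambda>A. FOb G (FOb F A)), FAr = (\<lambda>f. FAr G (FAr F f))\<rparr>"

definition preserves_monos ::
  "('o, 'a) cat \<Rightarrow> ('p, 'b) cat \<Rightarrow> ('o, 'a, 'p, 'b) cfunctor \<Rightarrow> bool" where
  "preserves_monos C D F \<longleftrightarrow> (\<forall>m. monic C m \<longrightarrow> monic D (FAr F m))"

definition nat_trans ::
  "('o, 'a) cat \<Rightarrow> ('p, 'b) cat \<Rightarrow> ('o, 'a, 'p, 'b) cfunctor \<Rightarrow> ('o, 'a, 'p, 'b) cfunctor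
     \<Rightarrow> ('o \<Rightarrow> 'b) \<Rightarrow> bool" where
  "nat_trans C D F G \<tau> \<longleftrightarrow>
     (\<forall>A \<in> Ob C. \<tau> A \<in> hom D (FOb F A) (FOb G A)) \<and>
     (\<forall>f \<in> Ar C. \<tau> (Cod C f) \<cdot>\<^bsub>D\<^esub> FAr F f = FAr G f \<cdot>\<^bsub>D\<^esub> \<tau> (Dom C f))"

definition nat_isomorphic ::
  "('o, 'a) cat \<Rightarrow> ('p, 'b) cat \<Rightarrow> ('o, 'a, 'p, 'b) cfunctor \<Rightarrow> ('o, 'a, 'p, 'b) cfunctor
     \<Rightarrow> bool" where
  "nat_isomorphic C D F G \<longleftrightarrow>
     (\<exists>\<tau>. nat_trans C D F G \<tau> \<and> (\<forall>A \<in> Ob C. is_iso D (\<tau> A)))"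

definition is_equivalence ::
  "('o, 'a) cat \<Rightarrow> ('p, 'b) cat \<Rightarrow> ('o, 'a, 'p, 'b) cfunctor \<Rightarrow> bool" where
  "is_equivalence C D F \<longleftrightarrow> is_functor C D F \<and>
     (\<exists>G. is_functor D C G \<and>
        nat_isomorphic C C (G \<circ>\<^sub>F F) id_functor \<and> nat_isomorphic D D (F \<circ>\<^sub>F G) id_functor)"

text \<open>\<open>L : C \<rightarrow> D\<close> is left adjoint to \<open>R : D \<rightarrow> C\<close> with unit \<open>\<eta>\<close>.\<close>

definition left_adjoint_unit ::
  "('o, 'a) cat \<Rightarrow> ('p, 'b) cat \<Rightarrow> ('o, 'a, 'p, 'b) cfunctor \<Rightarrow> ('p, 'b, 'o, 'a) cfunctor
     \<Rightarrow> ('o \<Rightarrow> 'a) \<Rightarrow> bool" where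
  "left_adjoint_unit C D L R \<eta> \<longleftrightarrow>
     is_functor C D L \<and> is_functor D C R \<and> nat_trans C C id_functor (R \<circ>\<^sub>F L) \<eta> \<and>
     (\<forall>X \<in> Ob C. \<forall>A \<in> Ob D. \<forall>f \<in> hom C X (FOb R A).
        \<exists>!g. g \<in> hom D (FOb L X) A \<and> FAr R g \<cdot>\<^bsub>C\<^esub> \<eta> X = f)"

definition is_cone ::
  "('j, 'u) cat \<Rightarrow> ('o, 'a) cat \<Rightarrow> ('j, 'u, 'o, 'a) cfunctor \<Rightarrow> 'o \<Rightarrow> ('j \<Rightarrow> 'a) \<Rightarrow> bool" where
  "is_cone J C D L \<pi> \<longleftrightarrow> L \<in> Ob C \<and>
     (\<forall>j \<in> Ob J. \<pi> j \<in> hom C L (FOb D j)) \<and>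
     (\<forall>u \<in> Ar J. FAr D u \<cdot>\<^bsub>C\<^esub> \<pi> (Dom J u) = \<pi> (Cod J u))"

definition is_limit ::
  "('j, 'u) cat \<Rightarrow> ('o, 'a) cat \<Rightarrow> ('j, 'u, 'o, 'a) cfunctor \<Rightarrow> 'o \<Rightarrow> ('j \<Rightarrow> 'a) \<Rightarrow> bool" where
  "is_limit J C D L \<pi> \<longleftrightarrow> is_cone J C D L \<pi> \<and>
     (\<forall>A \<sigma>. is_cone J C D A \<sigma> \<longrightarrow>
        (\<exists>!m. m \<in> hom C A L \<and> (\<forall>j \<in> Ob J. \<pi> j \<cdot>\<^bsub>C\<^esub> m = \<sigma> j)))"

text \<open>
  Every finite category is isomorphic to one whose objects and arrows are natural numbers, so it
  suffices to quantify over index categories of that type. Finitely many arrows entail finitely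
  many objects, because of the identities.
\<close>

definition finitely_complete :: "('o, 'a) cat \<Rightarrow> bool" where
  "finitely_complete C \<longleftrightarrow>
     (\<forall>(J :: (nat, nat) cat) D. category J \<and> finite (Ar J) \<and> is_functor J C D \<longrightarrow>
        (\<exists>L \<pi>. is_limit J C D L \<pi>))"

definition is_coequalizer :: "('o, 'a) cat \<Rightarrow> 'a \<Rightarrow> 'a \<Rightarrow> 'a \<Rightarrow> bool" where
  "is_coequalizer C f g q \<longleftrightarrow>
     f \<in> Ar C \<and> g \<in> hom C (Dom C f) (Cod C f) \<and>
     q \<in> Ar C \<and> Dom C q = Cod C f \<and> q \<cdot>\<^bsub>C\<^esub> f = q \<cdot>\<^bsub>C\<^esub> g \<and>
     (\<forall>Z. \<forall>h \<in> hom C (Cod C f) Z. h \<cdot>\<^bsub>C\<^esub> f = h \<cdot>\<^bsub>C\<^esub> g \<longrightarrow>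
        (\<exists>!k. k \<in> hom C (Cod C q) Z \<and> k \<cdot>\<^bsub>C\<^esub> q = h))"

definition has_coequalizers :: "('o, 'a) cat \<Rightarrow> bool" where
  "has_coequalizers C \<longleftrightarrow>
     (\<forall>A B. \<forall>f \<in> hom C A B. \<forall>g \<in> hom C A B. \<exists>q. is_coequalizer C f g q)"

definition regular_epi :: "('o, 'a) cat \<Rightarrow> 'a \<Rightarrow> bool" where
  "regular_epi C q \<longleftrightarrow> (\<exists>f g. is_coequalizer C f g q)"

definition regular_epis_compose :: "('o, 'a) cat \<Rightarrow> bool" where
  "regular_epis_compose C \<longleftrightarrow>
     (\<forall>p q. regular_epi C p \<and> regular_epi C q \<and> Dom C q = Cod C p \<longrightarrow>
        regular_epi C (q \<cdot>\<^bsub>C\<^esub> p))"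

definition is_coproduct ::
  "('o, 'a) cat \<Rightarrow> 'i set \<Rightarrow> ('i \<Rightarrow> 'o) \<Rightarrow> 'o \<Rightarrow> ('i \<Rightarrow> 'a) \<Rightarrow> bool" where
  "is_coproduct C I X P \<iota> \<longleftrightarrow> P \<in> Ob C \<and> (\<forall>i \<in> I. \<iota> i \<in> hom C (X i) P) \<and>
     (\<forall>Z \<in> Ob C. \<forall>f. (\<forall>i \<in> I. f i \<in> hom C (X i) Z) \<longrightarrow>
        (\<exists>!u. u \<in> hom C P Z \<and> (\<forall>i \<in> I. u \<cdot>\<^bsub>C\<^esub> \<iota> i = f i)))"

definition has_finite_coproducts :: "('o, 'a) cat \<Rightarrow> bool" where
  "has_finite_coproducts C \<longleftrightarrow>
     (\<forall>(k :: nat) X. (\<forall>i < k. X i \<in> Ob C) \<longrightarrow> (\<exists>P \<iota>. is_coproduct C {..<k} X P \<iota>))"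

text \<open>
  A choice of binary coproducts, meaningful in categories that have them. The functor below
  depends on the choice only up to natural isomorphism.
\<close>

definition sum_cocone :: "('o, 'a) cat \<Rightarrow> 'o \<Rightarrow> 'o \<Rightarrow> 'o \<times> (bool \<Rightarrow> 'a)" where
  "sum_cocone C A B =
     (SOME (P, \<iota>). is_coproduct C UNIV (\<lambda>b. if b then B else A) P \<iota>)"

definition sum_ob :: "('o, 'a) cat \<Rightarrow> 'o \<Rightarrow> 'o \<Rightarrow> 'o" where
  "sum_ob C A B = fst (sum_cocone C A B)"

definition sum_inl :: "('o, 'a) cat \<Rightarrow> 'o \<Rightarrow> 'o \<Rightarrow> 'a" where
  "sum_inl C A B = snd (sum_cocone C A B) False"

definition sum_inr :: "('o, 'a) cat \<Rightarrow> 'o \<Rightarrow> 'o \<Rightarrow> 'a" where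
  "sum_inr C A B = snd (sum_cocone C A B) True"

definition sum_ar :: "('o, 'a) cat \<Rightarrow> 'a \<Rightarrow> 'a \<Rightarrow> 'a" where
  "sum_ar C f g =
     (THE u. u \<in> hom C (sum_ob C (Dom C f) (Dom C g)) (sum_ob C (Cod C f) (Cod C g)) \<and>
        u \<cdot>\<^bsub>C\<^esub> sum_inl C (Dom C f) (Dom C g) = sum_inl C (Cod C f) (Cod C g) \<cdot>\<^bsub>C\<^esub> f \<and>
        u \<cdot>\<^bsub>C\<^esub> sum_inr C (Dom C f) (Dom C g) = sum_inr C (Cod C f) (Cod C g) \<cdot>\<^bsub>C\<^esub> g)"

definition prod_cat ::
  "('o, 'a) cat \<Rightarrow> ('p, 'b) cat \<Rightarrow> ('o \<times> 'p, 'a \<times> 'b) cat" where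
  "prod_cat C D =
     \<lparr>Ob = Ob C \<times> Ob D, Ar = Ar C \<times> Ar D,
      Dom = (\<lambda>(f, g). (Dom C f, Dom D g)), Cod = (\<lambda>(f, g). (Cod C f, Cod D g)),
      Id = (\<lambda>(A, B). (Id C A, Id D B)),
      Comp = (\<lambda>(f', g') (f, g). (f' \<cdot>\<^bsub>C\<^esub> f, g' \<cdot>\<^bsub>D\<^esub> g))\<rparr>"

text \<open>An arrow \<open>(f, h, g)\<close> of the slice category is the arrow \<open>h\<close> from \<open>f\<close> to \<open>g\<close> over \<open>Y\<close>.\<close>

definition slice :: "('o, 'a) cat \<Rightarrow> 'o \<Rightarrow> ('a, 'a \<times> 'a \<times> 'a) cat" where
  "slice C Y =
     \<lparr>Ob = {f \<in> Ar C. Cod C f = Y},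
      Ar = {(f, h, g). f \<in> Ar C \<and> Cod C f = Y \<and> g \<in> Ar C \<and> Cod C g = Y \<and>
                       h \<in> hom C (Dom C f) (Dom C g) \<and> g \<cdot>\<^bsub>C\<^esub> h = f},
      Dom = (\<lambda>(f, h, g). f), Cod = (\<lambda>(f, h, g). g),
      Id = (\<lambda>f. (f, Id C (Dom C f), f)),
      Comp = (\<lambda>(f', h', g') (f, h, g). (f, h' \<cdot>\<^bsub>C\<^esub> h, g'))\<rparr>"

definition slice_sum_functor ::
  "('o, 'a) cat \<Rightarrow>
     ('a \<times> 'a, ('a \<times> 'a \<times> 'a) \<times> ('a \<times> 'a \<times> 'a), 'a, 'a \<times> 'a \<times> 'a) cfunctor" where
  "slice_sum_functor C =
     \<lparr>FOb = (\<lambda>(f1, f2). sum_ar C f1 f2),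
      FAr = (\<lambda>((f1, h1, g1), (f2, h2, g2)).
               (sum_ar C f1 f2, sum_ar C h1 h2, sum_ar C g1 g2))\<rparr>"

definition extensive :: "('o, 'a) cat \<Rightarrow> bool" where
  "extensive C \<longleftrightarrow> has_finite_coproducts C \<and>
     (\<forall>Y1 \<in> Ob C. \<forall>Y2 \<in> Ob C.
        is_equivalence (prod_cat (slice C Y1) (slice C Y2)) (slice C (sum_ob C Y1 Y2))
          (slice_sum_functor C))"

text \<open>
  Families indexed by \<open>{..<n}\<close> are represented by functions that are \<open>undefined\<close> elsewhere, so that
  equality of functions is equality of families.
\<close>

definition power_cat :: "('o, 'a) cat \<Rightarrow> nat \<Rightarrow> (nat \<Rightarrow> 'o, nat \<Rightarrow> 'a) cat" where
  "power_cat C n =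
     \<lparr>Ob = {..<n} \<rightarrow>\<^sub>E Ob C, Ar = {..<n} \<rightarrow>\<^sub>E Ar C,
      Dom = (\<lambda>f. \<lambda>i\<in>{..<n}. Dom C (f i)), Cod = (\<lambda>f. \<lambda>i\<in>{..<n}. Cod C (f i)),
      Id = (\<lambda>X. \<lambda>i\<in>{..<n}. Id C (X i)),
      Comp = (\<lambda>g f. \<lambda>i\<in>{..<n}. g i \<cdot>\<^bsub>C\<^esub> f i)\<rparr>"

definition diag_functor :: "nat \<Rightarrow> ('o, 'a, nat \<Rightarrow> 'o, nat \<Rightarrow> 'a) cfunctor" where
  "diag_functor n = \<lparr>FOb = (\<lambda>X. \<lambda>i\<in>{..<n}. X), FAr = (\<lambda>f. \<lambda>i\<in>{..<n}. f)\<rparr>"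

lemma left_adjoint_diag_unit_is_coproduct:
  assumes C: "category C"
    and adj: "left_adjoint_unit (power_cat C n) C S (diag_functor n) \<eta>"
    and X: "X \<in> Ob (power_cat C n)"
  shows "is_coproduct C {..<n} X (FOb S X) (\<eta> X)"
proof -
  have S: "FOb S X \<in> Ob C"
    and \<eta>: "\<eta> X \<in> hom (power_cat C n) X (\<lambda>i\<in>{..<n}. FOb S X)"
    and univ: "\<And>A f. \<lbrakk>A \<in> Ob C; f \<in> hom (power_cat C n) X (\<lambda>i\<in>{..<n}. A)\<rbrakk> \<Longrightarrow>
        \<exists>!g. g \<in> hom C (FOb S X) A \<and> (\<lambda>i\<in>{..<n}. (\<lambda>i\<in>{..<n}. g) i \<cdot>\<^bsub>C\<^esub> \<eta> X i) = f"
    using adj X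
    by (auto simp: left_adjoint_unit_def is_functor_def nat_trans_def id_functor_def
        comp_functor_def diag_functor_def power_cat_def)
  have hom_iff: "f \<in> hom (power_cat C n) X (\<lambda>i\<in>{..<n}. A) \<longleftrightarrow>
      f \<in> extensional {..<n} \<and> (\<forall>i<n. f i \<in> hom C (X i) A)" for f A
    using X by (auto simp: hom_def power_cat_def PiE_iff fun_eq_iff restrict_def extensional_def)
  show ?thesis
    unfolding is_coproduct_def
  proof (intro conjI ballI allI impI)
    show "FOb S X \<in> Ob C" by (fact S)
    show "\<eta> X i \<in> hom C (X i) (FOb S X)" if "i \<in> {..<n}" for i
      using \<eta> that by (simp add: hom_iff)
  next
    fix Z f assume Z: "Z \<in> Ob C" and f: "\<forall>i\<in>{..<n}. f i \<in> hom C (X i) Z"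
    have "restrict f {..<n} \<in> hom (power_cat C n) X (\<lambda>i\<in>{..<n}. Z)"
      using f by (simp add: hom_iff)
    note ex1 = univ[OF Z this]
    have "((\<lambda>i\<in>{..<n}. (\<lambda>i\<in>{..<n}. g) i \<cdot>\<^bsub>C\<^esub> \<eta> X i) = restrict f {..<n}) \<longleftrightarrow>
        (\<forall>i\<in>{..<n}. g \<cdot>\<^bsub>C\<^esub> \<eta> X i = f i)" for g
      by (auto simp: fun_eq_iff)
    with ex1 show "\<exists>!u. u \<in> hom C (FOb S X) Z \<and> (\<forall>i\<in>{..<n}. u \<cdot>\<^bsub>C\<^esub> \<eta> X i = f i)"
      by (simp only:)
  qed
qed

definition is_coalgebra ::
  "('o, 'a) cat \<Rightarrow> ('o, 'a, 'o, 'a) cfunctor \<Rightarrow> 'o \<times> 'a \<Rightarrow> bool" where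
  "is_coalgebra B F X \<longleftrightarrow> fst X \<in> Ob B \<and> snd X \<in> hom B (fst X) (FOb F (fst X))"

definition coalg_mor ::
  "('o, 'a) cat \<Rightarrow> ('o, 'a, 'o, 'a) cfunctor \<Rightarrow> 'o \<times> 'a \<Rightarrow> 'o \<times> 'a \<Rightarrow> 'a \<Rightarrow> bool" where
  "coalg_mor B F X Y h \<longleftrightarrow>
     is_coalgebra B F X \<and> is_coalgebra B F Y \<and> h \<in> hom B (fst X) (fst Y) \<and>
     snd Y \<cdot>\<^bsub>B\<^esub> h = FAr F h \<cdot>\<^bsub>B\<^esub> snd X"

definition coalg_iso ::
  "('o, 'a) cat \<Rightarrow> ('o, 'a, 'o, 'a) cfunctor \<Rightarrow> 'o \<times> 'a \<Rightarrow> 'o \<times> 'a \<Rightarrow> 'a \<Rightarrow> bool" where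
  "coalg_iso B F X Y h \<longleftrightarrow> coalg_mor B F X Y h \<and>
     (\<exists>k. coalg_mor B F Y X k \<and>
        k \<cdot>\<^bsub>B\<^esub> h = Id B (fst X) \<and> h \<cdot>\<^bsub>B\<^esub> k = Id B (fst Y))"

definition coalg_quotient ::
  "('o, 'a) cat \<Rightarrow> ('o, 'a, 'o, 'a) cfunctor \<Rightarrow> 'o \<times> 'a \<Rightarrow> 'o \<times> 'a \<Rightarrow> 'a \<Rightarrow> bool" where
  "coalg_quotient B F X Y q \<longleftrightarrow> coalg_mor B F X Y q \<and> regular_epi B q"

definition simple_coalgebra ::
  "('o, 'a) cat \<Rightarrow> ('o, 'a, 'o, 'a) cfunctor \<Rightarrow> 'o \<times> 'a \<Rightarrow> bool" where
  "simple_coalgebra B F X \<longleftrightarrow> is_coalgebra B F X \<and>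
     (\<forall>Y q. coalg_quotient B F X Y q \<longrightarrow> coalg_iso B F X Y q)"

definition simple_quotient ::
  "('o, 'a) cat \<Rightarrow> ('o, 'a, 'o, 'a) cfunctor \<Rightarrow> 'o \<times> 'a \<Rightarrow> 'o \<times> 'a \<Rightarrow> 'a \<Rightarrow> bool" where
  "simple_quotient B F X Y q \<longleftrightarrow> coalg_quotient B F X Y q \<and> simple_coalgebra B F Y"

end

theory Submission
  imports Defs
begin

text \<open>
  A coalgebra structure for \<open>H\<close> on a quotient \<open>q\<close> of \<open>X\<close> is composed with \<open>H \<eta>\<close>. Conversely, if
  \<open>H \<eta>\<close> is monic, a structure for \<open>H \<Delta> \<Coprod>\<close> on the codomain of the regular epimorphism \<open>q\<close> yields
  one for \<open>H\<close> by the diagonal fill-in of \<open>q\<close> against \<open>H \<eta>\<close>. Since \<open>H\<close> preserves monomorphisms, it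
  remains to see that coproduct injections of an extensive category are monic. If
  \<open>inl \<cdot> a = inl \<cdot> b\<close> for \<open>a, b : A \<rightarrow> Y\<^sub>1\<close>, then \<open>a + !\<close> and \<open>b + !\<close> are the same arrow
  \<open>A + 0 \<rightarrow> Y\<^sub>1 + Y\<^sub>2\<close>; as the functor of extensivity is full, the identity of this arrow is \<open>h + k\<close>
  for some \<open>h\<close> with \<open>b \<cdot> h = a\<close>, and \<open>h = id\<close> because \<open>A + 0\<close> retracts onto \<open>A\<close>.
\<close>

section \<open>Arrows, functors, natural transformations, and fullness of equivalences\<close>

lemma hom_Dom_Cod: "f \<in> Ar C \<Longrightarrow> f \<in> hom C (Dom C f) (Cod C f)"
  by (simp add: hom_def)

lemma (in category) hom_Ob:
  assumes "f \<in> hom C A B"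
  shows "A \<in> Ob C" "B \<in> Ob C"
  using assms Dom_Ob Cod_Ob by (auto simp: hom_def)

lemma is_functor_hom:
  assumes "is_functor C D F" "f \<in> hom C A B"
  shows "FAr F f \<in> hom D (FOb F A) (FOb F B)"
  using assms by (auto simp: is_functor_def hom_def)

lemma is_functor_Comp:
  assumes "is_functor C D F" "f \<in> hom C A B" "g \<in> hom C B E"
  shows "FAr F (g \<cdot>\<^bsub>C\<^esub> f) = FAr F g \<cdot>\<^bsub>D\<^esub> FAr F f"
  using assms by (auto simp: is_functor_def hom_def)

lemma nat_trans_naturality:
  assumes "nat_trans C D F G \<tau>" "f \<in> hom C A B"
  shows "\<tau> B \<cdot>\<^bsub>D\<^esub> FAr F f = FAr G f \<cdot>\<^bsub>D\<^esub> \<tau> A"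
  using assms by (auto simp: nat_trans_def hom_def)

lemma is_isoE:
  assumes "is_iso C f" "f \<in> hom C A B"
  obtains g where "g \<in> hom C B A" "g \<cdot>\<^bsub>C\<^esub> f = Id C A" "f \<cdot>\<^bsub>C\<^esub> g = Id C B"
  using assms by (auto simp: is_iso_def hom_def)

lemma (in category) monic_cancel:
  assumes "g \<in> hom C B D" "f \<in> hom C A B" "monic C (g \<cdot> f)"
  shows "monic C f"
  unfolding monic_def
proof (intro conjI allI ballI impI)
  show "f \<in> Ar C" using assms(2) by (simp add: hom_def)
  fix E u v
  assume uv: "u \<in> hom C E (Dom C f)" "v \<in> hom C E (Dom C f)" "f \<cdot> u = f \<cdot> v"
  then have "(g \<cdot> f) \<cdot> u = (g \<cdot> f) \<cdot> v"
    using assms(1,2) Comp_assoc by (auto simp: hom_def)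
  moreover have "g \<cdot> f \<in> hom C A D" using assms Comp_hom by blast
  ultimately show "u = v"
    using assms uv unfolding monic_def by (auto simp: hom_def)
qed

text \<open>The candidate preimage of \<open>u\<close> is \<open>G u\<close> conjugated by the
  isomorphisms \<open>\<alpha>\<close>. Naturality of \<open>\<alpha>\<close> makes \<open>G\<close>
  agree on \<open>F w\<close> and \<open>u\<close>, and faithfulness of \<open>G\<close> then gives
  \<open>F w = u\<close>.\<close>

lemma is_equivalence_full:
  assumes C: "category C" and D: "category D"
    and eq: "is_equivalence C D F"
    and A: "A \<in> Ob C" and B: "B \<in> Ob C" and u: "u \<in> hom D (FOb F A) (FOb F B)"
  shows "\<exists>w \<in> hom C A B. FAr F w = u"
proof -
  interpret C: category C by (fact C)
  interpret D: category D by (fact D)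
  from eq obtain G \<alpha> \<beta> where F: "is_functor C D F" and G: "is_functor D C G"
    and \<alpha>: "nat_trans C C (G \<circ>\<^sub>F F) id_functor \<alpha>" "\<And>A. A \<in> Ob C \<Longrightarrow> is_iso C (\<alpha> A)"
    and \<beta>: "nat_trans D D (F \<circ>\<^sub>F G) id_functor \<beta>" "\<And>A. A \<in> Ob D \<Longrightarrow> is_iso D (\<beta> A)"
    unfolding is_equivalence_def nat_isomorphic_def by blast
  have \<alpha>_hom: "\<alpha> A \<in> hom C (FOb G (FOb F A)) A" if "A \<in> Ob C" for A
    using \<alpha>(1) that by (auto simp: nat_trans_def comp_functor_def id_functor_def)
  have \<beta>_hom: "\<beta> A \<in> hom D (FOb F (FOb G A)) A" if "A \<in> Ob D" for A
    using \<beta>(1) that by (auto simp: nat_trans_def comp_functor_def id_functor_def)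
  have \<alpha>_nat: "\<alpha> B \<cdot>\<^bsub>C\<^esub> FAr G (FAr F f) = f \<cdot>\<^bsub>C\<^esub> \<alpha> A" if "f \<in> hom C A B" for f A B
    using nat_trans_naturality[OF \<alpha>(1) that] by (simp add: comp_functor_def id_functor_def)
  have \<beta>_nat: "\<beta> B \<cdot>\<^bsub>D\<^esub> FAr F (FAr G f) = f \<cdot>\<^bsub>D\<^esub> \<beta> A" if "f \<in> hom D A B" for f A B
    using nat_trans_naturality[OF \<beta>(1) that] by (simp add: comp_functor_def id_functor_def)
  \<comment> \<open>\<open>\<beta>\<close> is natural, so equal images under \<open>G\<close> give
    arrows that agree after precomposition with \<open>\<beta> A\<close>; the right inverse
    \<open>b\<close> of \<open>\<beta> A\<close> cancels it.\<close>
  have faithful: "f = g"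
    if "f \<in> hom D A B" "g \<in> hom D A B" "FAr G f = FAr G g" for f g A B
  proof -
    have "A \<in> Ob D" using D.hom_Ob that by blast
    obtain b where b: "b \<in> hom D A (FOb F (FOb G A))" "\<beta> A \<cdot>\<^bsub>D\<^esub> b = Id D A"
      using is_isoE[OF \<beta>(2) \<beta>_hom] \<open>A \<in> Ob D\<close> by metis
    have "f \<cdot>\<^bsub>D\<^esub> \<beta> A = g \<cdot>\<^bsub>D\<^esub> \<beta> A"
      using \<beta>_nat that by metis
    then have "f \<cdot>\<^bsub>D\<^esub> (\<beta> A \<cdot>\<^bsub>D\<^esub> b) = g \<cdot>\<^bsub>D\<^esub> (\<beta> A \<cdot>\<^bsub>D\<^esub> b)"
      using D.Comp_assoc[OF b(1) \<beta>_hom] that \<open>A \<in> Ob D\<close> by metis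
    then show ?thesis using that b D.Comp_Id by metis
  qed
  obtain a where a: "a \<in> hom C A (FOb G (FOb F A))" "a \<cdot>\<^bsub>C\<^esub> \<alpha> A = Id C (FOb G (FOb F A))"
    using is_isoE[OF \<alpha>(2) \<alpha>_hom] A by metis
  obtain b where b: "b \<in> hom C B (FOb G (FOb F B))" "b \<cdot>\<^bsub>C\<^esub> \<alpha> B = Id C (FOb G (FOb F B))"
    using is_isoE[OF \<alpha>(2) \<alpha>_hom] B by metis
  note Gu = is_functor_hom[OF G u]
  \<comment> \<open>\<open>a\<close> is the inverse of \<open>\<alpha> A\<close>, so
    \<open>w\<close> is the only arrow for which the naturality square of \<open>\<alpha>\<close>
    can have \<open>G u\<close> on its other side.\<close>
  define w where "w = \<alpha> B \<cdot>\<^bsub>C\<^esub> (FAr G u \<cdot>\<^bsub>C\<^esub> a)"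
  have Gua: "FAr G u \<cdot>\<^bsub>C\<^esub> a \<in> hom C A (FOb G (FOb F B))"
    using C.Comp_hom a Gu by blast
  have w: "w \<in> hom C A B"
    unfolding w_def using C.Comp_hom Gua \<alpha>_hom[OF B] by blast
  note GFw = is_functor_hom[OF G is_functor_hom[OF F w]]
  have "\<alpha> B \<cdot>\<^bsub>C\<^esub> FAr G (FAr F w) = w \<cdot>\<^bsub>C\<^esub> \<alpha> A"
    by (rule \<alpha>_nat[OF w])
  also have "\<dots> = \<alpha> B \<cdot>\<^bsub>C\<^esub> ((FAr G u \<cdot>\<^bsub>C\<^esub> a) \<cdot>\<^bsub>C\<^esub> \<alpha> A)"
    unfolding w_def by (rule C.Comp_assoc[OF \<alpha>_hom[OF A] Gua \<alpha>_hom[OF B]])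
  also have "(FAr G u \<cdot>\<^bsub>C\<^esub> a) \<cdot>\<^bsub>C\<^esub> \<alpha> A = FAr G u"
    using C.Comp_assoc[OF \<alpha>_hom[OF A] a(1) Gu] a(2) C.Comp_Id[OF Gu] by simp
  \<comment> \<open>The left inverse \<open>b\<close> of \<open>\<alpha> B\<close> is applied in
    order to cancel \<open>\<alpha> B\<close>.\<close>
  finally have "b \<cdot>\<^bsub>C\<^esub> (\<alpha> B \<cdot>\<^bsub>C\<^esub> FAr G (FAr F w)) = b \<cdot>\<^bsub>C\<^esub> (\<alpha> B \<cdot>\<^bsub>C\<^esub> FAr G u)"
    by simp
  then have "FAr G (FAr F w) = FAr G u"
    using C.Comp_assoc[OF GFw \<alpha>_hom[OF B] b(1)] C.Comp_assoc[OF Gu \<alpha>_hom[OF B] b(1)]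
      b(2) C.Id_Comp[OF Gu] C.Id_Comp[OF GFw] by simp
  then have "FAr F w = u"
    using faithful is_functor_hom[OF F w] u by blast
  with w show ?thesis by blast
qed

section \<open>Products, slices and powers of categories\<close>

lemma category_prod_cat:
  assumes "category C" "category D"
  shows "category (prod_cat C D)"
proof -
  interpret C: category C by (fact assms)
  interpret D: category D by (fact assms)
  have hom: "f \<in> hom (prod_cat C D) A B \<longleftrightarrow>
      fst f \<in> hom C (fst A) (fst B) \<and> snd f \<in> hom D (snd A) (snd B)" for f A B
    by (cases f; cases A; cases B) (auto simp: hom_def prod_cat_def)
  show ?thesis
    by unfold_locales
      (auto simp: hom, auto simp: prod_cat_def split_beta prod_eq_iff
        intro: C.Dom_Ob C.Cod_Ob D.Dom_Ob D.Cod_Ob C.Id_hom D.Id_hom C.Comp_hom D.Comp_hom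
          C.Comp_Id D.Comp_Id C.Id_Comp D.Id_Comp C.Comp_assoc D.Comp_assoc)
qed

lemma (in category) category_slice: "category (slice C Y)"
proof -
  have hom: "t \<in> hom (slice C Y) a b \<longleftrightarrow>
      (\<exists>A B h. t = (a, h, b) \<and> a \<in> hom C A Y \<and> b \<in> hom C B Y \<and> h \<in> hom C A B \<and> b \<cdot> h = a)"
    for t a b
    by (cases t) (auto simp: hom_def slice_def)
  show ?thesis
  proof unfold_locales
    fix a assume "a \<in> Ob (slice C Y)"
    then show "Id (slice C Y) a \<in> hom (slice C Y) a a"
      using hom_Dom_Cod[of a C] Dom_Ob[of a] Id_hom[of "Dom C a"] Comp_Id[of a]
      unfolding hom by (fastforce simp: slice_def)
  next
    fix t a b s c assume "t \<in> hom (slice C Y) a b" "s \<in> hom (slice C Y) b c"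
    then show "s \<cdot>\<^bsub>slice C Y\<^esub> t \<in> hom (slice C Y) a c"
      unfolding hom using Comp_hom Comp_assoc by (fastforce simp: slice_def hom_def)
  next
    fix t a b assume "t \<in> hom (slice C Y) a b"
    then show "t \<cdot>\<^bsub>slice C Y\<^esub> Id (slice C Y) a = t" "Id (slice C Y) b \<cdot>\<^bsub>slice C Y\<^esub> t = t"
      unfolding hom by (auto simp: slice_def hom_def intro: Comp_Id Id_Comp)
  next
    fix t a b s c r d
    assume "t \<in> hom (slice C Y) a b" "s \<in> hom (slice C Y) b c" "r \<in> hom (slice C Y) c d"
    then show "(r \<cdot>\<^bsub>slice C Y\<^esub> s) \<cdot>\<^bsub>slice C Y\<^esub> t = r \<cdot>\<^bsub>slice C Y\<^esub> (s \<cdot>\<^bsub>slice C Y\<^esub> t)"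
      unfolding hom by (auto simp: slice_def hom_def intro!: Comp_assoc)
  qed (auto simp: slice_def)
qed

text \<open>Domains and codomains in the power category are restricted functions. They can equal
  \<open>A\<close> and \<open>B\<close> only if these are \<open>undefined\<close> outside
  \<open>{..<n}\<close>, hence the two assumptions; under them the typing of \<open>f\<close> is
  componentwise.\<close>

lemma hom_power_cat_iff:
  assumes "A \<in> extensional {..<n}" "B \<in> extensional {..<n}"
  shows "f \<in> hom (power_cat C n) A B \<longleftrightarrow>
    f \<in> extensional {..<n} \<and> (\<forall>i<n. f i \<in> hom C (A i) (B i))"
proof -
  have iff: "restrict h {..<n} = E \<longleftrightarrow> (\<forall>i<n. h i = E i)" if E: "E \<in> extensional {..<n}"
    for h E :: "nat \<Rightarrow> 'a"
  proof
    show "\<forall>i<n. h i = E i" if "restrict h {..<n} = E"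
      unfolding that[symmetric] by simp
    show "restrict h {..<n} = E" if "\<forall>i<n. h i = E i"
      by (rule extensionalityI[OF restrict_extensional E]) (use that in simp)
  qed
  show ?thesis
    unfolding hom_def power_cat_def
    by (simp only: cat.simps mem_Collect_eq iff[OF assms(1)] iff[OF assms(2)] PiE_iff) auto
qed

lemma hom_power_catD:
  assumes "f \<in> hom (power_cat C n) A B"
  shows "A \<in> extensional {..<n}" "B \<in> extensional {..<n}" "f \<in> extensional {..<n}"
    "i < n \<Longrightarrow> f i \<in> hom C (A i) (B i)"
proof -
  show AB: "A \<in> extensional {..<n}" "B \<in> extensional {..<n}"
    using assms by (auto simp: hom_def power_cat_def)
  show "f \<in> extensional {..<n}" "i < n \<Longrightarrow> f i \<in> hom C (A i) (B i)"
    using assms unfolding hom_power_cat_iff[OF AB] by simp_all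
qed

lemma (in category) category_power_cat: "category (power_cat C n)"
proof -
  have Comp: "(g \<cdot>\<^bsub>power_cat C n\<^esub> f) = (\<lambda>i\<in>{..<n}. g i \<cdot> f i)" for f g
    by (simp add: power_cat_def)
  show ?thesis
  proof unfold_locales
    fix A assume "A \<in> Ob (power_cat C n)"
    then show "Id (power_cat C n) A \<in> hom (power_cat C n) A A"
      using Id_hom by (auto simp: power_cat_def PiE_iff hom_def fun_eq_iff extensional_def)
  next
    fix f A B g D assume "f \<in> hom (power_cat C n) A B" "g \<in> hom (power_cat C n) B D"
    note h = hom_power_catD[OF this(1)] hom_power_catD[OF this(2)]
    show "g \<cdot>\<^bsub>power_cat C n\<^esub> f \<in> hom (power_cat C n) A D"
      unfolding Comp hom_power_cat_iff[OF h(1,6)] using h by (auto intro: Comp_hom)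
  next
    fix f A B assume "f \<in> hom (power_cat C n) A B"
    note h = hom_power_catD[OF this]
    show "f \<cdot>\<^bsub>power_cat C n\<^esub> Id (power_cat C n) A = f"
      "Id (power_cat C n) B \<cdot>\<^bsub>power_cat C n\<^esub> f = f"
      unfolding Comp using h(3) Comp_Id[OF h(4)] Id_Comp[OF h(4)]
      by (auto simp: power_cat_def fun_eq_iff extensional_def)
  next
    fix f A B g D h E
    assume "f \<in> hom (power_cat C n) A B" "g \<in> hom (power_cat C n) B D"
      "h \<in> hom (power_cat C n) D E"
    note h = this[THEN hom_power_catD(4)]
    show "(h \<cdot>\<^bsub>power_cat C n\<^esub> g) \<cdot>\<^bsub>power_cat C n\<^esub> f =
        h \<cdot>\<^bsub>power_cat C n\<^esub> (g \<cdot>\<^bsub>power_cat C n\<^esub> f)"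
      unfolding Comp using h by (auto simp: fun_eq_iff intro: Comp_assoc)
  qed (use Dom_Ob Cod_Ob in \<open>auto simp: power_cat_def\<close>)
qed

lemma monic_power_catI:
  assumes m: "m \<in> hom (power_cat C n) A B" and mi: "\<And>i. i < n \<Longrightarrow> monic C (m i)"
  shows "monic (power_cat C n) m"
  unfolding monic_def
proof (intro conjI allI ballI impI)
  show "m \<in> Ar (power_cat C n)" using m by (simp add: hom_def)
  have DA: "Dom (power_cat C n) m = A" using m by (simp add: hom_def)
  fix E f g
  assume "f \<in> hom (power_cat C n) E (Dom (power_cat C n) m)"
    "g \<in> hom (power_cat C n) E (Dom (power_cat C n) m)"
  note f = hom_power_catD[OF this(1)[unfolded DA]] and g = hom_power_catD[OF this(2)[unfolded DA]]
  assume eq: "m \<cdot>\<^bsub>power_cat C n\<^esub> f = m \<cdot>\<^bsub>power_cat C n\<^esub> g"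
  have "f i = g i" if i: "i < n" for i
  proof -
    have "m i \<cdot>\<^bsub>C\<^esub> f i = m i \<cdot>\<^bsub>C\<^esub> g i"
      using fun_cong[OF eq, of i] i by (simp add: power_cat_def)
    moreover have "Dom C (m i) = A i" using hom_power_catD(4)[OF m i] by (simp add: hom_def)
    ultimately show ?thesis
      using mi[OF i] f(4)[OF i] g(4)[OF i] unfolding monic_def by auto
  qed
  then show "f = g" using f(3) g(3) by (auto intro: extensionalityI)
qed

section \<open>Binary sums and coproduct injections in extensive categories\<close>

lemma is_coproductD:
  assumes "is_coproduct C I X P \<iota>"
  shows "P \<in> Ob C" "i \<in> I \<Longrightarrow> \<iota> i \<in> hom C (X i) P"
    "\<lbrakk>Z \<in> Ob C; \<And>i. i \<in> I \<Longrightarrow> f i \<in> hom C (X i) Z\<rbrakk> \<Longrightarrow>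
       \<exists>!u. u \<in> hom C P Z \<and> (\<forall>i\<in>I. u \<cdot>\<^bsub>C\<^esub> \<iota> i = f i)"
proof -
  show "P \<in> Ob C" "i \<in> I \<Longrightarrow> \<iota> i \<in> hom C (X i) P"
    using assms[unfolded is_coproduct_def] by blast+
  have univ: "\<forall>Z\<in>Ob C. \<forall>f. (\<forall>i\<in>I. f i \<in> hom C (X i) Z) \<longrightarrow>
      (\<exists>!u. u \<in> hom C P Z \<and> (\<forall>i\<in>I. u \<cdot>\<^bsub>C\<^esub> \<iota> i = f i))"
    by (rule assms[unfolded is_coproduct_def, THEN conjunct2, THEN conjunct2])
  show "\<exists>!u. u \<in> hom C P Z \<and> (\<forall>i\<in>I. u \<cdot>\<^bsub>C\<^esub> \<iota> i = f i)"
    if "Z \<in> Ob C" "\<And>i. i \<in> I \<Longrightarrow> f i \<in> hom C (X i) Z"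
    by (rule univ[rule_format, OF that])
qed

locale cat_with_finite_coproducts = category +
  assumes coproducts: "has_finite_coproducts C"
begin

lemma initial_ob: "\<exists>Z\<in>Ob C. \<forall>A\<in>Ob C. \<exists>!f. f \<in> hom C Z A"
proof -
  \<comment> \<open>The coproduct of the empty family is an initial object.\<close>
  obtain Z \<iota> where "is_coproduct C {..<0::nat} (\<lambda>_. undefined) Z \<iota>"
    using coproducts unfolding has_finite_coproducts_def by blast
  then have "Z \<in> Ob C \<and> (\<forall>A\<in>Ob C. \<exists>!f. f \<in> hom C Z A)"
    by (simp add: is_coproduct_def)
  then show ?thesis by (intro bexI[of _ Z]) (elim conjE, assumption)+
qed

text \<open>The choice in \<open>sum_cocone\<close> is indexed by \<open>bool\<close>, while the
  assumed coproducts are indexed by initial segments of the naturals. Reindexing a coproduct over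
  \<open>{..<2}\<close> yields a witness for the choice operator, so the chosen cocone is a
  coproduct.\<close>

lemma sum_is_coproduct:
  assumes "A \<in> Ob C" "B \<in> Ob C"
  shows "is_coproduct C UNIV (\<lambda>b. if b then B else A) (sum_ob C A B)
           (\<lambda>b. if b then sum_inr C A B else sum_inl C A B)"
proof -
  have "\<exists>P \<iota>. is_coproduct C {..<2} (\<lambda>i::nat. if i = 1 then B else A) P \<iota>"
    using assms by (intro coproducts[unfolded has_finite_coproducts_def, rule_format]) simp
  then obtain P \<iota> where "is_coproduct C {..<2} (\<lambda>i::nat. if i = 1 then B else A) P \<iota>"
    by blast
  note P = is_coproductD[OF this]
  have "is_coproduct C UNIV (\<lambda>b. if b then B else A) P (\<lambda>b. \<iota> (if b then 1 else 0))"
    unfolding is_coproduct_def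
  proof (intro conjI allI ballI impI)
    show "P \<in> Ob C" by (fact P)
    show "\<iota> (if b then 1 else 0) \<in> hom C (if b then B else A) P" for b
      using P(2)[of 0] P(2)[of 1] by auto
    fix Z f assume Z: "Z \<in> Ob C" and f: "\<forall>b\<in>UNIV. f b \<in> hom C (if b then B else A) Z"
    \<comment> \<open>The test \<open>i = 1\<close> inverts the reindexing that sends
      \<open>False\<close> to 0 and \<open>True\<close> to 1.\<close>
    have "\<exists>!u. u \<in> hom C P Z \<and> (\<forall>i\<in>{..<2}. u \<cdot> \<iota> i = f (i = 1))"
      by (rule P(3)[OF Z]) (rule bspec[OF f UNIV_I])
    moreover have "(\<forall>i\<in>{..<2}. u \<cdot> \<iota> i = f (i = 1)) \<longleftrightarrow>
        (\<forall>b\<in>UNIV. u \<cdot> \<iota> (if b then 1 else 0) = f b)" for u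
      by (simp add: all_bool_eq lessThan_Suc numeral_2_eq_2)
    ultimately show "\<exists>!u. u \<in> hom C P Z \<and> (\<forall>b\<in>UNIV. u \<cdot> \<iota> (if b then 1 else 0) = f b)"
      by (simp only:)
  qed
  then have "(\<lambda>(P, \<iota>). is_coproduct C UNIV (\<lambda>b. if b then B else A) P \<iota>) (sum_cocone C A B)"
    unfolding sum_cocone_def by (intro someI_ex[OF exI]) (rule case_prodI)
  moreover have "snd (sum_cocone C A B) = (\<lambda>b. if b then sum_inr C A B else sum_inl C A B)"
    by (auto simp: sum_inl_def sum_inr_def)
  ultimately show ?thesis by (simp add: sum_ob_def split_beta)
qed

lemma sum_ob_Ob: "\<lbrakk>A \<in> Ob C; B \<in> Ob C\<rbrakk> \<Longrightarrow> sum_ob C A B \<in> Ob C"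
  using sum_is_coproduct is_coproductD(1) by metis

lemma sum_inl_hom: "\<lbrakk>A \<in> Ob C; B \<in> Ob C\<rbrakk> \<Longrightarrow> sum_inl C A B \<in> hom C A (sum_ob C A B)"
  using is_coproductD(2)[OF sum_is_coproduct, of A B False] by simp

lemma sum_inr_hom: "\<lbrakk>A \<in> Ob C; B \<in> Ob C\<rbrakk> \<Longrightarrow> sum_inr C A B \<in> hom C B (sum_ob C A B)"
  using is_coproductD(2)[OF sum_is_coproduct, of A B True] by simp

lemma sum_universal:
  assumes f: "f \<in> hom C A Z" and g: "g \<in> hom C B Z"
  shows "\<exists>!u. u \<in> hom C (sum_ob C A B) Z \<and> u \<cdot> sum_inl C A B = f \<and> u \<cdot> sum_inr C A B = g"
proof -
  have "\<exists>!u. u \<in> hom C (sum_ob C A B) Z \<and>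
      (\<forall>b\<in>UNIV. u \<cdot> (if b then sum_inr C A B else sum_inl C A B) = (if b then g else f))"
    using f g hom_Ob
    by (intro is_coproductD(3)[OF sum_is_coproduct, of A B]) (auto split: if_splits)
  then show ?thesis by (simp add: all_bool_eq conj_commute)
qed

text \<open>All parts follow from the description of \<open>sum_ar C f g\<close> as the unique arrow
  with given composites with the injections. As \<open>f\<close> enters that description only
  through its type and \<open>sum_inl C A' B' \<cdot> f\<close>, arrows identified by the injection
  have the same sum with \<open>g\<close>; this is \<open>sum_ar_cong\<close>.\<close>

lemma sum_ar_props:
  assumes f: "f \<in> hom C A A'" and g: "g \<in> hom C B B'"
  shows "sum_ar C f g \<in> hom C (sum_ob C A B) (sum_ob C A' B')"
    "sum_ar C f g \<cdot> sum_inl C A B = sum_inl C A' B' \<cdot> f"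
    "sum_ar C f g \<cdot> sum_inr C A B = sum_inr C A' B' \<cdot> g"
    and sum_ar_cong: "\<lbrakk>f' \<in> hom C A A'; sum_inl C A' B' \<cdot> f' = sum_inl C A' B' \<cdot> f\<rbrakk>
      \<Longrightarrow> sum_ar C f' g = sum_ar C f g"
proof -
  have "sum_inl C A' B' \<cdot> f \<in> hom C A (sum_ob C A' B')"
    "sum_inr C A' B' \<cdot> g \<in> hom C B (sum_ob C A' B')"
    using f g hom_Ob sum_inl_hom sum_inr_hom Comp_hom by meson+
  from theI'[OF sum_universal[OF this]]
  show "sum_ar C f g \<in> hom C (sum_ob C A B) (sum_ob C A' B')"
    "sum_ar C f g \<cdot> sum_inl C A B = sum_inl C A' B' \<cdot> f"
    "sum_ar C f g \<cdot> sum_inr C A B = sum_inr C A' B' \<cdot> g"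
    using f g by (simp_all add: sum_ar_def hom_def)
  show "sum_ar C f' g = sum_ar C f g"
    if "f' \<in> hom C A A'" "sum_inl C A' B' \<cdot> f' = sum_inl C A' B' \<cdot> f"
    using f g that by (simp add: sum_ar_def hom_def)
qed

lemma extensive_sum_inl_monic:
  assumes ext: "extensive C" and Y1: "Y1 \<in> Ob C" and Y2: "Y2 \<in> Ob C"
  shows "monic C (sum_inl C Y1 Y2)"
  unfolding monic_def
proof (intro conjI allI ballI impI)
  note inl = sum_inl_hom[OF Y1 Y2]
  show "sum_inl C Y1 Y2 \<in> Ar C" using inl by (simp add: hom_def)
  have DY: "Dom C (sum_inl C Y1 Y2) = Y1" using inl by (simp add: hom_def)
  fix A a b
  assume a: "a \<in> hom C A (Dom C (sum_inl C Y1 Y2))" and b: "b \<in> hom C A (Dom C (sum_inl C Y1 Y2))"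
    and eq: "sum_inl C Y1 Y2 \<cdot> a = sum_inl C Y1 Y2 \<cdot> b"
  note a = a[unfolded DY] and b = b[unfolded DY]
  have A: "A \<in> Ob C" using a hom_Ob by blast
  \<comment> \<open>An initial second summand supplies both an object \<open>z\<close> of the slice
    over \<open>Y2\<close> and the arrow \<open>zA\<close>, from which the retraction
    \<open>r\<close> of \<open>A + Z\<close> onto \<open>A\<close> is formed.\<close>
  obtain Z where Z: "Z \<in> Ob C" "\<forall>A\<in>Ob C. \<exists>!f. f \<in> hom C Z A"
    using initial_ob by (elim bexE)
  obtain z where z: "z \<in> hom C Z Y2" using Z(2) Y2 by blast
  obtain zA where zA: "zA \<in> hom C Z A" using Z(2) A by blast
  note s = sum_ar_props(1)[OF a z]
  have ab: "sum_ar C b z = sum_ar C a z"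
    by (rule sum_ar_cong[OF a z b]) (simp add: eq)
  let ?P = "prod_cat (slice C Y1) (slice C Y2)"
  \<comment> \<open>An identity arrow, with source \<open>a + z\<close> and target
    \<open>b + z\<close> in the slice; it is well typed in this way because these two objects
    coincide by \<open>ab\<close>.\<close>
  let ?i = "(sum_ar C a z, Id C (sum_ob C A Z), sum_ar C a z)"
  have "\<exists>w \<in> hom ?P (a, z) (b, z). FAr (slice_sum_functor C) w = ?i"
  proof (rule is_equivalence_full)
    show "category ?P" "category (slice C (sum_ob C Y1 Y2))"
      by (intro category_prod_cat category_slice category_axioms)+
    show "is_equivalence ?P (slice C (sum_ob C Y1 Y2)) (slice_sum_functor C)"
      using ext Y1 Y2 by (simp add: extensive_def)
    show "(a, z) \<in> Ob ?P" "(b, z) \<in> Ob ?P"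
      using a b z by (auto simp: prod_cat_def slice_def hom_def)
    show "?i \<in> hom (slice C (sum_ob C Y1 Y2))
        (FOb (slice_sum_functor C) (a, z)) (FOb (slice_sum_functor C) (b, z))"
      using s Id_hom[OF sum_ob_Ob[OF A Z(1)]] Comp_Id[OF s]
      by (auto simp: slice_sum_functor_def ab slice_def hom_def)
  qed
  \<comment> \<open>A preimage of \<open>?i\<close> is a pair of triples \<open>(a, h, b)\<close>
    and \<open>(z, k, z)\<close>. The slice condition on the first is
    \<open>b \<cdot> h = a\<close>, and comparing middle components gives \<open>hk\<close>.\<close>
  then obtain h k where h: "h \<in> hom C A A" and k: "k \<in> hom C Z Z" and bh: "b \<cdot> h = a"
    and hk: "sum_ar C h k = Id C (sum_ob C A Z)"
    using a b z by (fastforce simp: hom_def prod_cat_def slice_def slice_sum_functor_def)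
  note i = sum_inl_hom[OF A Z(1)]
  have ih: "sum_inl C A Z \<cdot> h = sum_inl C A Z"
    using sum_ar_props(2)[OF h k] Id_Comp[OF i] by (simp add: hk)
  obtain r where r: "r \<in> hom C (sum_ob C A Z) A" "r \<cdot> sum_inl C A Z = Id C A"
    using sum_universal[OF Id_hom[OF A] zA] by blast
  have "h = (r \<cdot> sum_inl C A Z) \<cdot> h" using r Id_Comp[OF h] by simp
  also have "\<dots> = Id C A" using Comp_assoc[OF h i r(1)] ih r by simp
  finally show "a = b" using bh Comp_Id[OF b] by simp
qed

lemma extensive_coproduct_injection_monic:
  assumes ext: "extensive C" and cop: "is_coproduct C I X P \<iota>"
    and X: "\<And>i. i \<in> I \<Longrightarrow> X i \<in> Ob C" and i: "i \<in> I"
  shows "monic C (\<iota> i)"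
proof -
  note P = is_coproductD[OF cop]
  let ?S = "sum_ob C (X i) P"
  note inl = sum_inl_hom[OF X[OF i] P(1)] and inr = sum_inr_hom[OF X[OF i] P(1)]
  \<comment> \<open>\<open>\<iota> i\<close> is a first factor of \<open>inl : X i \<rightarrow> X i + P\<close>; this avoids forming the coproduct of the
    remaining summands.\<close>
  have "\<exists>!u. u \<in> hom C P ?S \<and>
      (\<forall>j\<in>I. u \<cdot> \<iota> j = (if j = i then sum_inl C (X i) P else sum_inr C (X i) P \<cdot> \<iota> j))"
    using inl Comp_hom[OF P(2) inr] by (intro P(3)[OF sum_ob_Ob[OF X[OF i] P(1)]]) simp
  then obtain u where u: "u \<in> hom C P ?S"
    "\<forall>j\<in>I. u \<cdot> \<iota> j = (if j = i then sum_inl C (X i) P else sum_inr C (X i) P \<cdot> \<iota> j)"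
    by blast
  then have "monic C (u \<cdot> \<iota> i)"
    using extensive_sum_inl_monic[OF ext X[OF i] P(1)] i by simp
  then show ?thesis using monic_cancel u(1) P(2)[OF i] by blast
qed

end

section \<open>Coalgebras, their quotients and simplicity along a pointed endofunctor\<close>

text \<open>An inverse in the base category is automatically a coalgebra morphism. Being an
  isomorphism of coalgebras is thus a property of the carrying arrow, which lets simplicity pass
  between different functors.\<close>

lemma (in category) coalg_mor_iso:
  assumes F: "is_functor C C F" and h: "coalg_mor C F X Y h"
    and k: "k \<in> hom C (fst Y) (fst X)" "k \<cdot> h = Id C (fst X)" "h \<cdot> k = Id C (fst Y)"
  shows "coalg_iso C F X Y h"
proof -
  from h have X: "fst X \<in> Ob C" "snd X \<in> hom C (fst X) (FOb F (fst X))"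
    and Y: "fst Y \<in> Ob C" "snd Y \<in> hom C (fst Y) (FOb F (fst Y))"
    and hh: "h \<in> hom C (fst X) (fst Y)" and comm: "snd Y \<cdot> h = FAr F h \<cdot> snd X"
    by (auto simp: coalg_mor_def is_coalgebra_def)
  note Fh = is_functor_hom[OF F hh] and Fk = is_functor_hom[OF F k(1)]
  have FkFh: "FAr F k \<cdot> FAr F h = Id C (FOb F (fst X))"
    using is_functor_Comp[OF F hh k(1)] k(2) F X by (simp add: is_functor_def)
  \<comment> \<open>Inserting \<open>F k \<cdot> F h\<close> on the left brings \<open>F h\<close>
    next to \<open>snd X\<close>, where the morphism square of \<open>h\<close> applies.\<close>
  have "snd X \<cdot> k = (FAr F k \<cdot> FAr F h) \<cdot> (snd X \<cdot> k)"
    using FkFh Id_Comp[OF Comp_hom[OF k(1) X(2)]] by simp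
  also have "\<dots> = FAr F k \<cdot> ((FAr F h \<cdot> snd X) \<cdot> k)"
    using Comp_assoc[OF Comp_hom[OF k(1) X(2)] Fh Fk] Comp_assoc[OF k(1) X(2) Fh] by simp
  also have "\<dots> = FAr F k \<cdot> (snd Y \<cdot> (h \<cdot> k))"
    using comm Comp_assoc[OF k(1) hh Y(2)] by simp
  also have "\<dots> = FAr F k \<cdot> snd Y" using k(3) Comp_Id[OF Y(2)] by simp
  finally have "coalg_mor C F Y X k" using h k(1) by (auto simp: coalg_mor_def)
  with h k show ?thesis unfolding coalg_iso_def by blast
qed

lemma is_functor_comp:
  assumes "is_functor C D F" "is_functor D E G"
  shows "is_functor C E (G \<circ>\<^sub>F F)"
  using assms by (auto simp: is_functor_def comp_functor_def hom_def)

text \<open>The locale isolates what the coalgebra argument takes from extensivity: a natural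
  transformation from the identity to \<open>T\<close> whose components \<open>H\<close> sends to
  monomorphisms. \<open>T\<close> stands for the diagonal after the coproduct.\<close>

locale pointed_extension = category B for B (structure) +
  fixes H T :: "('o, 'a, 'o, 'a) cfunctor" and \<eta> :: "'o \<Rightarrow> 'a"
  assumes H: "is_functor B B H" and T: "is_functor B B T"
    and \<eta>: "nat_trans B B id_functor T \<eta>"
    and H\<eta>_monic: "Y \<in> Ob B \<Longrightarrow> monic B (FAr H (\<eta> Y))"
begin

lemma H\<eta>_hom: "Y \<in> Ob B \<Longrightarrow> FAr H (\<eta> Y) \<in> hom B (FOb H Y) (FOb (H \<circ>\<^sub>F T) Y)"
  using \<eta> is_functor_hom[OF H, of "\<eta> Y" Y "FOb T Y"]
  by (auto simp: nat_trans_def id_functor_def comp_functor_def)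

lemma H\<eta>_nat:
  assumes q: "q \<in> hom B X Y"
  shows "FAr (H \<circ>\<^sub>F T) q \<cdot> FAr H (\<eta> X) = FAr H (\<eta> Y) \<cdot> FAr H q"
proof -
  have "\<eta> X \<in> hom B X (FOb T X)" "\<eta> Y \<in> hom B Y (FOb T Y)"
    using \<eta> hom_Ob[OF q] by (auto simp: nat_trans_def id_functor_def)
  then show ?thesis
    using nat_trans_naturality[OF \<eta> q] is_functor_Comp[OF H] is_functor_hom[OF T q] q
    by (metis cfunctor.select_convs comp_functor_def id_functor_def)
qed

lemma induced_coalgebra:
  assumes "is_coalgebra B H (X, \<xi>)"
  shows "is_coalgebra B (H \<circ>\<^sub>F T) (X, FAr H (\<eta> X) \<cdot> \<xi>)"
  using assms H\<eta>_hom Comp_hom by (auto simp: is_coalgebra_def)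

text \<open>By naturality of \<open>\<eta>\<close>, the right-hand leg of a morphism square for
  \<open>H \<circ>\<^sub>F T\<close> is \<open>H \<eta>\<close> after the corresponding leg for
  \<open>H\<close>. Both directions of the comparison of quotients rest on this.\<close>

lemma induced_square:
  assumes X: "is_coalgebra B H (X, \<xi>)" and q: "q \<in> hom B X Y"
  shows "FAr (H \<circ>\<^sub>F T) q \<cdot> (FAr H (\<eta> X) \<cdot> \<xi>) = FAr H (\<eta> Y) \<cdot> (FAr H q \<cdot> \<xi>)"
proof -
  have \<xi>: "\<xi> \<in> hom B X (FOb H X)" and "X \<in> Ob B" "Y \<in> Ob B"
    using X hom_Ob[OF q] by (auto simp: is_coalgebra_def)
  then show ?thesis
    using Comp_assoc[OF \<xi> H\<eta>_hom is_functor_hom[OF is_functor_comp[OF T H] q]]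
      Comp_assoc[OF \<xi> is_functor_hom[OF H q] H\<eta>_hom] H\<eta>_nat[OF q] by simp
qed

lemma coalg_mor_induced:
  assumes q: "coalg_mor B H (X, \<xi>) (Y, \<zeta>) q"
  shows "coalg_mor B (H \<circ>\<^sub>F T) (X, FAr H (\<eta> X) \<cdot> \<xi>) (Y, FAr H (\<eta> Y) \<cdot> \<zeta>) q"
proof -
  from q have X: "is_coalgebra B H (X, \<xi>)" and Y: "is_coalgebra B H (Y, \<zeta>)"
    and qh: "q \<in> hom B X Y" and comm: "\<zeta> \<cdot> q = FAr H q \<cdot> \<xi>"
    by (auto simp: coalg_mor_def)
  have "(FAr H (\<eta> Y) \<cdot> \<zeta>) \<cdot> q = FAr H (\<eta> Y) \<cdot> (FAr H q \<cdot> \<xi>)"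
    using Comp_assoc[OF qh _ H\<eta>_hom] Y comm by (auto simp: is_coalgebra_def)
  with induced_square[OF X qh] induced_coalgebra[OF X] induced_coalgebra[OF Y] qh
  show ?thesis by (simp add: coalg_mor_def)
qed

lemma coalg_quotient_induced:
  "coalg_quotient B H (X, \<xi>) (Y, \<zeta>) q \<Longrightarrow>
    coalg_quotient B (H \<circ>\<^sub>F T) (X, FAr H (\<eta> X) \<cdot> \<xi>) (Y, FAr H (\<eta> Y) \<cdot> \<zeta>) q"
  using coalg_mor_induced by (simp add: coalg_quotient_def)

text \<open>Besides the structure \<open>\<zeta>\<close>, the fill-in gives that
  \<open>\<zeta>'\<close> is the structure induced by \<open>\<zeta>\<close>; so every quotient of
  an induced coalgebra is itself induced, which the transfer of simplicity requires.\<close>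

lemma coalg_quotient_lift:
  assumes X: "is_coalgebra B H (X, \<xi>)"
    and q: "coalg_quotient B (H \<circ>\<^sub>F T) (X, FAr H (\<eta> X) \<cdot> \<xi>) (Y, \<zeta>') q"
  obtains \<zeta> where "coalg_quotient B H (X, \<xi>) (Y, \<zeta>) q" "\<zeta>' = FAr H (\<eta> Y) \<cdot> \<zeta>"
proof -
  from q have qh: "q \<in> hom B X Y" and \<zeta>': "\<zeta>' \<in> hom B Y (FOb (H \<circ>\<^sub>F T) Y)"
    and comm: "\<zeta>' \<cdot> q = FAr (H \<circ>\<^sub>F T) q \<cdot> (FAr H (\<eta> X) \<cdot> \<xi>)" and "regular_epi B q"
    by (auto simp: coalg_quotient_def coalg_mor_def is_coalgebra_def)
  then obtain f g where fg: "is_coequalizer B f g q" by (auto simp: regular_epi_def)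
  have Y: "Y \<in> Ob B" and \<xi>: "\<xi> \<in> hom B X (FOb H X)"
    using hom_Ob[OF qh] X by (auto simp: is_coalgebra_def)
  define A where "A = Dom B f"
  have f: "f \<in> hom B A X" and g: "g \<in> hom B A X" and qfg: "q \<cdot> f = q \<cdot> g"
    and univ: "\<And>Z h. \<lbrakk>h \<in> hom B X Z; h \<cdot> f = h \<cdot> g\<rbrakk> \<Longrightarrow> \<exists>!k. k \<in> hom B Y Z \<and> k \<cdot> q = h"
    using fg qh by (auto simp: is_coequalizer_def hom_def A_def)
  note m = H\<eta>_hom[OF Y]
  define p where "p = FAr H q \<cdot> \<xi>"
  have p: "p \<in> hom B X (FOb H Y)"
    unfolding p_def using Comp_hom[OF \<xi> is_functor_hom[OF H qh]] .
  have mp: "FAr H (\<eta> Y) \<cdot> p = \<zeta>' \<cdot> q"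
    using induced_square[OF X qh] comm by (simp add: p_def)
  \<comment> \<open>By \<open>mp\<close>, equality of \<open>q \<cdot> f\<close> and
    \<open>q \<cdot> g\<close> passes to \<open>p \<cdot> f\<close> and \<open>p \<cdot> g\<close>
    after composition with \<open>H \<eta>\<close>, which is monic. Hence \<open>p\<close> factors
    through the coequalizer \<open>q\<close>.\<close>
  have "FAr H (\<eta> Y) \<cdot> (p \<cdot> e) = \<zeta>' \<cdot> (q \<cdot> e)" if "e \<in> hom B A X" for e
    using Comp_assoc[OF that p m] Comp_assoc[OF that qh \<zeta>'] mp by simp
  then have "FAr H (\<eta> Y) \<cdot> (p \<cdot> f) = FAr H (\<eta> Y) \<cdot> (p \<cdot> g)" using f g qfg by simp
  moreover have "Dom B (FAr H (\<eta> Y)) = FOb H Y" using m by (simp add: hom_def)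
  ultimately have "p \<cdot> f = p \<cdot> g"
    using H\<eta>_monic[OF Y] Comp_hom[OF f p] Comp_hom[OF g p] unfolding monic_def by metis
  then obtain \<zeta> where \<zeta>: "\<zeta> \<in> hom B Y (FOb H Y)" "\<zeta> \<cdot> q = p" using univ[OF p] by blast
  have "(FAr H (\<eta> Y) \<cdot> \<zeta>) \<cdot> q = \<zeta>' \<cdot> q"
    using Comp_assoc[OF qh \<zeta>(1) m] \<zeta>(2) mp by simp
  moreover have "(\<zeta>' \<cdot> q) \<cdot> f = (\<zeta>' \<cdot> q) \<cdot> g"
    using Comp_assoc[OF f qh \<zeta>'] Comp_assoc[OF g qh \<zeta>'] qfg by simp
  \<comment> \<open>Both sides factor \<open>\<zeta>' \<cdot> q\<close> through \<open>q\<close>,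
    and such factorizations are unique.\<close>
  ultimately have "\<zeta>' = FAr H (\<eta> Y) \<cdot> \<zeta>"
    using univ[OF Comp_hom[OF qh \<zeta>']] \<zeta>' Comp_hom[OF \<zeta>(1) m] by blast
  moreover have "coalg_quotient B H (X, \<xi>) (Y, \<zeta>) q"
    using X Y \<zeta> qh \<open>regular_epi B q\<close>
    by (simp add: coalg_quotient_def coalg_mor_def is_coalgebra_def p_def)
  ultimately show ?thesis using that by blast
qed

text \<open>The two coalgebras have quotients carried by the same arrows. If such an arrow is an
  isomorphism for one functor, it has an inverse in the base category, and
  \<open>coalg_mor_iso\<close> makes it an isomorphism for the other.\<close>

lemma simple_induced_iff:
  assumes Y: "is_coalgebra B H (Y, \<zeta>)"
  shows "simple_coalgebra B (H \<circ>\<^sub>F T) (Y, FAr H (\<eta> Y) \<cdot> \<zeta>) \<longleftrightarrow> simple_coalgebra B H (Y, \<zeta>)"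
proof
  assume s: "simple_coalgebra B H (Y, \<zeta>)"
  show "simple_coalgebra B (H \<circ>\<^sub>F T) (Y, FAr H (\<eta> Y) \<cdot> \<zeta>)"
    unfolding simple_coalgebra_def
  proof (intro conjI allI impI induced_coalgebra Y)
    fix W q assume q: "coalg_quotient B (H \<circ>\<^sub>F T) (Y, FAr H (\<eta> Y) \<cdot> \<zeta>) W q"
    obtain Z \<theta>' where W: "W = (Z, \<theta>')" by (cases W)
    obtain \<theta> where "coalg_quotient B H (Y, \<zeta>) (Z, \<theta>) q"
      using coalg_quotient_lift[OF Y q[unfolded W]] .
    then have "coalg_iso B H (Y, \<zeta>) (Z, \<theta>) q" using s by (simp add: simple_coalgebra_def)
    then obtain k where "k \<in> hom B Z Y" "k \<cdot> q = Id B Y" "q \<cdot> k = Id B Z"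
      by (auto simp: coalg_iso_def coalg_mor_def)
    then show "coalg_iso B (H \<circ>\<^sub>F T) (Y, FAr H (\<eta> Y) \<cdot> \<zeta>) W q"
      using coalg_mor_iso[OF is_functor_comp[OF T H]] q by (simp add: coalg_quotient_def W)
  qed
next
  assume s: "simple_coalgebra B (H \<circ>\<^sub>F T) (Y, FAr H (\<eta> Y) \<cdot> \<zeta>)"
  show "simple_coalgebra B H (Y, \<zeta>)"
    unfolding simple_coalgebra_def
  proof (intro conjI allI impI Y)
    fix W q assume q: "coalg_quotient B H (Y, \<zeta>) W q"
    obtain Z \<theta> where W: "W = (Z, \<theta>)" by (cases W)
    have "coalg_iso B (H \<circ>\<^sub>F T) (Y, FAr H (\<eta> Y) \<cdot> \<zeta>) (Z, FAr H (\<eta> Z) \<cdot> \<theta>) q"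
      using s coalg_quotient_induced[OF q[unfolded W]] by (simp add: simple_coalgebra_def)
    then obtain k where "k \<in> hom B Z Y" "k \<cdot> q = Id B Y" "q \<cdot> k = Id B Z"
      by (auto simp: coalg_iso_def coalg_mor_def)
    then show "coalg_iso B H (Y, \<zeta>) W q"
      using coalg_mor_iso[OF H] q by (simp add: coalg_quotient_def W)
  qed
qed

lemma quotient_iff:
  assumes X: "is_coalgebra B H (X, \<xi>)"
  shows "(\<exists>\<zeta>. coalg_quotient B H (X, \<xi>) (Y, \<zeta>) q) \<longleftrightarrow>
    (\<exists>\<zeta>'. coalg_quotient B (H \<circ>\<^sub>F T) (X, FAr H (\<eta> X) \<cdot> \<xi>) (Y, \<zeta>') q)"
  using coalg_quotient_induced coalg_quotient_lift[OF X] by metis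

lemma simple_quotient_iff:
  assumes X: "is_coalgebra B H (X, \<xi>)"
  shows "(\<exists>\<zeta>. simple_quotient B H (X, \<xi>) (Y, \<zeta>) q) \<longleftrightarrow>
    (\<exists>\<zeta>'. simple_quotient B (H \<circ>\<^sub>F T) (X, FAr H (\<eta> X) \<cdot> \<xi>) (Y, \<zeta>') q)"
proof -
  \<comment> \<open>Simplicity is restated for the induced coalgebra on \<open>Y\<close>. Since
    every \<open>\<zeta>'\<close> on the right-hand side of the goal is of this induced form, only
    the correspondence of quotients remains.\<close>
  have "simple_quotient B H (X, \<xi>) (Y, \<zeta>) q \<longleftrightarrow>
      coalg_quotient B H (X, \<xi>) (Y, \<zeta>) q \<and>
      simple_coalgebra B (H \<circ>\<^sub>F T) (Y, FAr H (\<eta> Y) \<cdot> \<zeta>)" for \<zeta>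
    using simple_induced_iff
    by (auto simp: simple_quotient_def coalg_quotient_def coalg_mor_def)
  then show ?thesis
    using coalg_quotient_induced coalg_quotient_lift[OF X]
    unfolding simple_quotient_def by metis
qed

end

section \<open>The pointed endofunctor given by the diagonal and the coproduct\<close>

theorem corollary8p16:
  fixes C :: "('o, 'a) cat" and n :: nat
    and H :: "(nat \<Rightarrow> 'o, nat \<Rightarrow> 'a, nat \<Rightarrow> 'o, nat \<Rightarrow> 'a) cfunctor"
    and S :: "(nat \<Rightarrow> 'o, nat \<Rightarrow> 'a, 'o, 'a) cfunctor"
    and \<eta> :: "(nat \<Rightarrow> 'o) \<Rightarrow> (nat \<Rightarrow> 'a)"
    and X :: "nat \<Rightarrow> 'o" and \<xi> :: "nat \<Rightarrow> 'a"
  defines "Cn \<equiv> power_cat C n"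
    and "H' \<equiv> H \<circ>\<^sub>F diag_functor n \<circ>\<^sub>F S"
    and "\<xi>' \<equiv> FAr H (\<eta> X) \<cdot>\<^bsub>power_cat C n\<^esub> \<xi>"
  assumes "category C"
    and "finitely_complete C"
    and "has_coequalizers C"
    and "has_finite_coproducts C"
    and "regular_epis_compose C"
    and "left_adjoint_unit Cn C S (diag_functor n) \<eta>"
    and "is_functor Cn Cn H"
    and "preserves_monos Cn Cn H"
    and "extensive C"
    and "is_coalgebra Cn H (X, \<xi>)"
  shows "is_coalgebra Cn H' (X, \<xi>') \<and>
    (\<forall>Y. \<forall>q \<in> hom Cn X Y. regular_epi Cn q \<longrightarrow>
       ((\<exists>\<zeta>. coalg_mor Cn H (X, \<xi>) (Y, \<zeta>) q) \<longleftrightarrow>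
        (\<exists>\<zeta>'. coalg_mor Cn H' (X, \<xi>') (Y, \<zeta>') q))) \<and>
    (\<forall>Y q. (\<exists>\<zeta>. simple_quotient Cn H (X, \<xi>) (Y, \<zeta>) q) \<longleftrightarrow>
           (\<exists>\<zeta>'. simple_quotient Cn H' (X, \<xi>') (Y, \<zeta>') q))"
proof -
  let ?T = "diag_functor n \<circ>\<^sub>F S"
  interpret C: cat_with_finite_coproducts C
    using assms(4,7) by (simp add: cat_with_finite_coproducts_def cat_with_finite_coproducts_axioms_def)
  note adj = \<open>left_adjoint_unit Cn C S (diag_functor n) \<eta>\<close>
  have unit: "nat_trans Cn Cn id_functor ?T \<eta>" and "is_functor Cn C S"
    "is_functor C Cn (diag_functor n)"
    using adj by (simp_all add: left_adjoint_unit_def)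
  then have T: "is_functor Cn Cn ?T" using is_functor_comp by blast
  \<comment> \<open>The components of the unit are families of coproduct injections, which are monic
    by extensivity; monicity in the power category is checked componentwise.\<close>
  have \<eta>_monic: "monic Cn (\<eta> Y)" if Y: "Y \<in> Ob Cn" for Y
    unfolding Cn_def
  proof (rule monic_power_catI)
    show "\<eta> Y \<in> hom (power_cat C n) Y (FOb ?T Y)"
      using unit Y by (simp add: nat_trans_def Cn_def id_functor_def)
    show "monic C (\<eta> Y i)" if "i < n" for i
      using left_adjoint_diag_unit_is_coproduct[OF assms(4) adj[unfolded Cn_def]] Y that
      by (intro C.extensive_coproduct_injection_monic[OF \<open>extensive C\<close>, where I="{..<n}" and X=Y])
        (auto simp: Cn_def power_cat_def)
  qed
  interpret pointed_extension Cn H ?T \<eta>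
  proof (intro pointed_extension.intro pointed_extension_axioms.intro)
    show "category Cn" unfolding Cn_def by (rule C.category_power_cat)
    show "monic Cn (FAr H (\<eta> Y))" if "Y \<in> Ob Cn" for Y
      using \<open>preserves_monos Cn Cn H\<close> \<eta>_monic[OF that] by (simp add: preserves_monos_def)
  qed (fact T unit \<open>is_functor Cn Cn H\<close>)+
  note X = \<open>is_coalgebra Cn H (X, \<xi>)\<close>
  \<comment> \<open>Composition of functors associates to the right, so \<open>H'\<close> is
    literally \<open>H \<circ>\<^sub>F ?T\<close> and the results of the locale apply as they
    stand.\<close>
  show ?thesis
    using induced_coalgebra[OF X] quotient_iff[OF X] simple_quotient_iff[OF X]
    unfolding H'_def \<xi>'_def Cn_def[symmetric] coalg_quotient_def by blast
qed

end
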